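(* Let $f^{\mathrm{GEV}}$ be the objective function of the maximum capture problem under generalized extreme value (GEV) models, $$f^{\mathrm{GEV}}(S)=\sum_{i\in I}q_i-\sum_{i\in I}\frac{q_i}{1+G^i(\mathbf{Y}^i|S)},\qquad S\subseteq[m].$$ Then for every $S\subseteq [m]$ and every $j\in[m]\setminus S$, $$f^{\mathrm{GEV}}(S\cup\{j\})>f^{\mathrm{GEV}}(S).$$
   Context: Let $[m]=\{1,\dots,m\}$ be the set of candidate locations, and $I$ a finite nonempty set of customer zones. Zone $i\in I$ has $q_i>0$ customers, with deterministic utilities $v_{ij}\in\mathbb{R}$ for $j\in[m]$; let $\mathbf{Y}^i\in\mathbb{R}^m$ have entries $Y^i_j=e^{v_{ij}}>0$. Each zone $i$ has a choice probability generating function (CPGF) $G^i$ of a GEV model. A CPGF is a function $G:\mathbb{R}^m_+\to\mathbb{R}$ on the closed nonnegative orthant, continuous on $\mathbb{R}^m_+$ and possessing continuous mixed partial derivatives of all orders on the open positive orthant (where $\partial G_{j_1\dots j_k}$ denotes the mixed partial derivative with respect to $Y_{j_1},\dots,Y_{j_k}$), such that: (i) $G(\mathbf{Y})\ge 0$ for all $\mathbf{Y}\in\mathbb{R}^m_+$; (ii) $G(\lambda\mathbf{Y})=\lambda G(\mathbf{Y})$ for all $\lambda>0$; (iii) $G(\mathbf{Y})\to\infty$ if $Y_j\to\infty$ for some $j$; (iv) on the open positive orthant, for distinct $j_1,\dots,j_k\in[m]$: $\partial G_{j_1}(\mathbf{Y})>0$ when $k=1$, $\partial G_{j_1\dots j_k}(\mathbf{Y})\ge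 0$ when $k\geq 3$ is odd, and $\partial G_{j_1\dots j_k}(\mathbf{Y})\le 0$ when $k$ is even; (v) $G(\mathbf{Y})=\sum_{j\in[m]}Y_j\,\partial G_j(\mathbf{Y})$ on the open positive orthant; (vi) $\sum_{k\in[m]}Y_k\,\partial G_{jk}(\mathbf{Y})=0$ for all $j\in[m]$ on the open positive orthant. For $S\subseteq[m]$, $G^i(\mathbf{Y}^i|S):=G^i(\widetilde{\mathbf{Y}}^i)$, where $\widetilde Y^i_j=Y^i_j$ if $j\in S$ and $\widetilde Y^i_j=0$ otherwise. The quantity $f^{\mathrm{GEV}}(S)$ is the expected captured demand when facilities are opened at $S$ (the competitors' total utility being normalized to $1$). *)

theory Defs
  imports "HOL-Analysis.Analysis"
begin

text \<open>
  The set of candidate locations is the universe of a finite type \<open>'m\<close>,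
  so that utility vectors live in \<open>real ^ 'm\<close>.
\<close>

definition nonneg_orthant :: "(real ^ 'm::finite) set" where
  "nonneg_orthant = {Y. \<forall>j. 0 \<le> Y $ j}"

definition pos_orthant :: "(real ^ 'm::finite) set" where
  "pos_orthant = {Y. \<forall>j. 0 < Y $ j}"

definition set_coord :: "real ^ 'm::finite \<Rightarrow> 'm \<Rightarrow> real \<Rightarrow> real ^ 'm" where
  "set_coord Y j t = (\<chi> k. if k = j then t else Y $ k)"

definition partial_deriv ::
  "(real ^ 'm::finite \<Rightarrow> real) \<Rightarrow> 'm \<Rightarrow> real ^ 'm \<Rightarrow> real" where
  "partial_deriv G j Y = deriv (\<lambda>t. G (set_coord Y j t)) (Y $ j)"

text \<open>
  The indices are differentiated from left to right, so \<open>mixed_partial G [j, k]\<close>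
  is the partial derivative in direction \<open>k\<close> of the partial derivative in direction \<open>j\<close>.
\<close>

fun mixed_partial ::
  "(real ^ 'm::finite \<Rightarrow> real) \<Rightarrow> 'm list \<Rightarrow> real ^ 'm \<Rightarrow> real" where
  "mixed_partial G [] = G"
| "mixed_partial G (j # js) = mixed_partial (partial_deriv G j) js"

text \<open>
  Functions are total, but every condition below only involves the values of \<open>G\<close>
  on the closed nonnegative orthant. Since \<open>deriv\<close> is total, the existence of all the partial
  derivatives is required explicitly (\<open>partials_exist\<close>); index lists may contain repetitions.
  In \<open>unbounded\<close> the other coordinates are held fixed.
\<close>

locale cpgf =
  fixes G :: "real ^ 'm::finite \<Rightarrow> real"
  assumes continuous: "continuous_on nonneg_orthant G"
    and partials_exist:
      "\<And>js j Y. Y \<in> pos_orthant \<Longrightarrow>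
        (\<lambda>t. mixed_partial G js (set_coord Y j t)) field_differentiable (at (Y $ j))"
    and partials_continuous: "\<And>js. continuous_on pos_orthant (mixed_partial G js)"
    and nonneg: "\<And>Y. Y \<in> nonneg_orthant \<Longrightarrow> 0 \<le> G Y"
    and homogeneous:
      "\<And>Y c. Y \<in> nonneg_orthant \<Longrightarrow> 0 < c \<Longrightarrow> G (c *\<^sub>R Y) = c * G Y"
    and unbounded:
      "\<And>Y j. Y \<in> nonneg_orthant \<Longrightarrow> filterlim (\<lambda>t. G (set_coord Y j t)) at_top at_top"
    and partial_pos: "\<And>j Y. Y \<in> pos_orthant \<Longrightarrow> 0 < mixed_partial G [j] Y"
    and partial_odd:
      "\<And>js Y. Y \<in> pos_orthant \<Longrightarrow> distinct js \<Longrightarrow> 3 \<le> length js \<Longrightarrow> odd (length js) \<Longrightarrow>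
        0 \<le> mixed_partial G js Y"
    and partial_even:
      "\<And>js Y. Y \<in> pos_orthant \<Longrightarrow> distinct js \<Longrightarrow> js \<noteq> [] \<Longrightarrow> even (length js) \<Longrightarrow>
        mixed_partial G js Y \<le> 0"
    and euler: "\<And>Y. Y \<in> pos_orthant \<Longrightarrow> G Y = (\<Sum>j\<in>UNIV. Y $ j * mixed_partial G [j] Y)"
    and euler_partial:
      "\<And>j Y. Y \<in> pos_orthant \<Longrightarrow> (\<Sum>k\<in>UNIV. Y $ k * mixed_partial G [j, k] Y) = 0"

definition exp_utility :: "('i \<Rightarrow> 'm \<Rightarrow> real) \<Rightarrow> 'i \<Rightarrow> real ^ 'm::finite" where
  "exp_utility v i = (\<chi> j. exp (v i j))"

definition restrict_to :: "real ^ 'm::finite \<Rightarrow> 'm set \<Rightarrow> real ^ 'm" where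
  "restrict_to Y S = (\<chi> j. if j \<in> S then Y $ j else 0)"

definition f_GEV ::
  "'i set \<Rightarrow> ('i \<Rightarrow> real) \<Rightarrow> ('i \<Rightarrow> 'm \<Rightarrow> real) \<Rightarrow> ('i \<Rightarrow> real ^ 'm::finite \<Rightarrow> real) \<Rightarrow> 'm set \<Rightarrow> real" where
  "f_GEV I q v G S =
    (\<Sum>i\<in>I. q i) - (\<Sum>i\<in>I. q i / (1 + G i (restrict_to (exp_utility v i) S)))"

end

theory Submission imports Defs begin

text \<open>
  Opening location \<open>j\<close> raises one coordinate of the utility vector from \<open>0\<close> to a positive value while
  the unopened locations keep the coordinate \<open>0\<close>. This happens on the boundary of the orthant, where
  the CPGF need not be differentiable, and the positivity of \<open>\<partial>\<^sub>j G\<close> in the interior alone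
  gives only a weak inequality in the limit. Strictness comes from the sign of the second-order partials:
  since \<open>\<partial>\<^sub>k \<partial>\<^sub>j G \<le> 0\<close> for \<open>k \<noteq> j\<close>, the derivative \<open>\<partial>\<^sub>j G\<close> can only grow when other
  coordinates shrink, so \<open>G\<close> has decreasing differences: the gain from raising coordinate \<open>j\<close> is the
  larger, the smaller the other coordinates are (\<open>decreasing_differences_interior\<close>).
  This property involves only values of \<open>G\<close> and so passes by continuity to the closed orthant
  (\<open>decreasing_differences\<close>).

  Hence the gain from adding \<open>j\<close> to \<open>S\<close> is at least the gain from adding \<open>j\<close> when all other locations are
  open. There the other coordinates are positive, so the segment along which coordinate \<open>j\<close> grows
  meets the boundary only in its initial point, and the gain is strictly positive
  by the mean value theorem (\<open>strict_mono_coordinate\<close>). Finally \<open>x \<mapsto> - q / (1 + x)\<close> is strictly increasing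
  for \<open>x \<ge> 0\<close>, so that every zone contributes strictly more.
\<close>

lemma set_coord_nth [simp]: "set_coord Y j t $ k = (if k = j then t else Y $ k)"
  by (simp add: set_coord_def)

lemma set_coord_set_coord [simp]: "set_coord (set_coord Y j s) j t = set_coord Y j t"
  by (simp add: vec_eq_iff)

lemma set_coord_same [simp]: "set_coord Y j (Y $ j) = Y"
  by (simp add: vec_eq_iff)

lemma continuous_on_set_coord: "continuous_on A (set_coord Y j)"
  unfolding set_coord_def
proof (rule continuous_on_vec_lambda)
  show "continuous_on A (\<lambda>t. if k = j then t else Y $ k)" for k
    by (cases "k = j") (auto intro: continuous_intros)
qed

text \<open>
  Passing from \<open>u\<close> to \<open>w\<close> one coordinate at a time stays in the open orthant, so that
  conditions on single partial derivatives suffice to compare the two endpoints. Coordinate \<open>j\<close> is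
  exempt because a CPGF is convex rather than concave in a single coordinate: only the mixed second
  partials in distinct directions are nonpositive.
\<close>

lemma antimono_by_coordinates:
  fixes F :: "real ^ 'm::finite \<Rightarrow> real"
  assumes step: "\<And>Y k t. Y \<in> pos_orthant \<Longrightarrow> k \<noteq> j \<Longrightarrow> Y $ k \<le> t \<Longrightarrow> F (set_coord Y k t) \<le> F Y"
    and u: "u \<in> pos_orthant" and uw: "\<And>k. u $ k \<le> w $ k" and j: "u $ j = w $ j"
  shows "F w \<le> F u"
proof -
  define mix where "mix A = (\<chi> k. if k \<in> A then w $ k else u $ k)" for A
  have pos: "mix A \<in> pos_orthant" for A
    using u uw by (auto simp: mix_def pos_orthant_def intro: less_le_trans)
  have "F (mix A) \<le> F u" if "finite A" for A
    using that
  proof (induction A rule: finite_induct)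
    case empty
    have "mix {} = u" by (simp add: mix_def vec_eq_iff)
    then show ?case by simp
  next
    case (insert k A)
    show ?case
    proof (cases "k = j")
      case True
      then have "mix (insert k A) = mix A" using j by (auto simp: mix_def vec_eq_iff)
      then show ?thesis using insert by simp
    next
      case False
      have "mix (insert k A) = set_coord (mix A) k (w $ k)" by (auto simp: mix_def vec_eq_iff)
      moreover have "mix A $ k \<le> w $ k" using uw by (simp add: mix_def)
      ultimately have "F (mix (insert k A)) \<le> F (mix A)"
        using step[OF pos False] by simp
      then show ?thesis using insert by simp
    qed
  qed
  from this[of UNIV] show ?thesis by (simp add: mix_def)
qed

context cpgf
begin

lemma has_partial_derivative:
  assumes "set_coord Y j t \<in> pos_orthant"
  shows "((\<lambda>t. mixed_partial G js (set_coord Y j t)) has_real_derivative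
           partial_deriv (mixed_partial G js) j (set_coord Y j t)) (at t)"
proof -
  have "(\<lambda>t. mixed_partial G js (set_coord Y j t)) field_differentiable at t"
    using partials_exist[OF assms, of js j] by simp
  then show ?thesis
    by (simp add: partial_deriv_def DERIV_deriv_iff_field_differentiable)
qed

lemma partial_antimono:
  assumes "u \<in> pos_orthant" "\<And>k. u $ k \<le> w $ k" "u $ j = w $ j"
  shows "partial_deriv G j w \<le> partial_deriv G j u"
  using _ assms
proof (rule antimono_by_coordinates)
  fix Y :: "real ^ 'm" and k t
  assume Y: "Y \<in> pos_orthant" and k: "k \<noteq> j" and t: "Y $ k \<le> t"
  have "partial_deriv G j (set_coord Y k t) \<le> partial_deriv G j (set_coord Y k (Y $ k))"
  proof (rule DERIV_nonpos_imp_nonincreasing[OF t])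
    fix x assume "Y $ k \<le> x" "x \<le> t"
    then have x: "set_coord Y k x \<in> pos_orthant"
      using Y by (auto simp: pos_orthant_def intro: less_le_trans)
    show "\<exists>y. ((\<lambda>t. partial_deriv G j (set_coord Y k t)) has_real_derivative y) (at x) \<and> y \<le> 0"
      using has_partial_derivative[OF x, of "[j]"] partial_even[OF x, of "[j, k]"] k by auto
  qed
  then show "partial_deriv G j (set_coord Y k t) \<le> partial_deriv G j Y" by simp
qed

lemma decreasing_differences_interior:
  assumes u: "u \<in> pos_orthant" and uw: "\<And>k. u $ k \<le> w $ k" and s: "0 < s" and st: "s \<le> t"
  shows "G (set_coord w j t) - G (set_coord w j s) \<le> G (set_coord u j t) - G (set_coord u j s)"
proof -
  let ?D = "\<lambda>x. G (set_coord u j x) - G (set_coord w j x)"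
  have "?D s \<le> ?D t"
  proof (rule DERIV_nonneg_imp_nondecreasing[OF st])
    fix x assume "s \<le> x" "x \<le> t"
    then have ux: "set_coord u j x \<in> pos_orthant" and wx: "set_coord w j x \<in> pos_orthant"
      using u s uw by (auto simp: pos_orthant_def intro: less_le_trans)
    have "(?D has_real_derivative
        partial_deriv G j (set_coord u j x) - partial_deriv G j (set_coord w j x)) (at x)"
      using has_partial_derivative[OF ux, of "[]"] has_partial_derivative[OF wx, of "[]"]
      by (auto intro: DERIV_diff)
    moreover have "partial_deriv G j (set_coord w j x) \<le> partial_deriv G j (set_coord u j x)"
      by (rule partial_antimono[OF ux]) (use uw in auto)
    ultimately show "\<exists>y. (?D has_real_derivative y) (at x) \<and> 0 \<le> y" by force
  qed
  then show ?thesis by simp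
qed

text \<open>
  Translating a nonnegative vector by \<open>(\<epsilon>, \<dots>, \<epsilon>)\<close> moves it into the open orthant, where the partial
  derivatives are available, and continuity controls the limit \<open>\<epsilon> \<rightarrow> 0\<close>.
\<close>

lemma tendsto_shift:
  assumes "Y \<in> nonneg_orthant"
  shows "((\<lambda>\<epsilon>. G (Y + vec \<epsilon>)) \<longlongrightarrow> G Y) (at_right 0)"
proof (rule continuous_on_tendsto_compose[OF continuous _ assms])
  have "((\<lambda>\<epsilon>. Y + vec \<epsilon>) \<longlongrightarrow> Y + vec 0) (at_right 0)"
    by (intro tendsto_add tendsto_const, unfold vec_def, rule tendsto_vec_lambda)
       (rule tendsto_ident_at)
  moreover have "vec 0 = (0 :: real ^ 'm)" by (simp add: vec_eq_iff)
  ultimately show "((\<lambda>\<epsilon>. Y + vec \<epsilon>) \<longlongrightarrow> Y) (at_right 0)" by simp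
  show "\<forall>\<^sub>F \<epsilon> in at_right 0. Y + vec \<epsilon> \<in> nonneg_orthant"
    using assms by (auto simp: nonneg_orthant_def eventually_at_filter)
qed

lemma decreasing_differences:
  assumes u: "u \<in> nonneg_orthant" and uw: "\<And>k. u $ k \<le> w $ k" and s: "0 \<le> s" and st: "s \<le> t"
  shows "G (set_coord w j t) - G (set_coord w j s) \<le> G (set_coord u j t) - G (set_coord u j s)"
proof -
  have w: "w \<in> nonneg_orthant"
    using u uw by (auto simp: nonneg_orthant_def intro: order_trans)
  have coord: "set_coord Y j r \<in> nonneg_orthant" if "Y \<in> nonneg_orthant" "0 \<le> r" for Y r
    using that by (simp add: nonneg_orthant_def)
  have shift: "set_coord Y j r + vec \<epsilon> = set_coord (Y + vec \<epsilon>) j (r + \<epsilon>)" for Y r \<epsilon>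
    by (simp add: vec_eq_iff)
  have lim: "((\<lambda>\<epsilon>. G (set_coord Y j t + vec \<epsilon>) - G (set_coord Y j s + vec \<epsilon>))
      \<longlongrightarrow> G (set_coord Y j t) - G (set_coord Y j s)) (at_right 0)"
    if "Y \<in> nonneg_orthant" for Y
    using that s st by (intro tendsto_diff tendsto_shift coord) auto
  have ev: "\<forall>\<^sub>F \<epsilon> in at_right 0.
      G (set_coord w j t + vec \<epsilon>) - G (set_coord w j s + vec \<epsilon>)
      \<le> G (set_coord u j t + vec \<epsilon>) - G (set_coord u j s + vec \<epsilon>)"
    using eventually_at_right_less
  proof (rule eventually_mono)
    fix \<epsilon> :: real assume "0 < \<epsilon>"
    then have "u + vec \<epsilon> \<in> pos_orthant"
      using u by (auto simp: nonneg_orthant_def pos_orthant_def intro: add_nonneg_pos)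
    then show "G (set_coord w j t + vec \<epsilon>) - G (set_coord w j s + vec \<epsilon>)
      \<le> G (set_coord u j t + vec \<epsilon>) - G (set_coord u j s + vec \<epsilon>)"
      unfolding shift
      by (rule decreasing_differences_interior) (use uw s st \<open>0 < \<epsilon>\<close> in auto)
  qed
  show ?thesis
    by (rule tendsto_le[OF _ lim[OF u] lim[OF w] ev]) simp
qed

text \<open>
  The lower end \<open>s = 0\<close> is allowed: the mean value theorem needs differentiability
  only strictly between \<open>s\<close> and \<open>t\<close>, and continuity at the ends.
\<close>

lemma strict_mono_coordinate:
  assumes w: "w \<in> pos_orthant" and s: "0 \<le> s" and st: "s < t"
  shows "G (set_coord w j s) < G (set_coord w j t)"
proof (rule DERIV_pos_imp_increasing_open[OF st])
  fix x assume "s < x" "x < t"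
  then have x: "set_coord w j x \<in> pos_orthant"
    using w s by (simp add: pos_orthant_def)
  show "\<exists>y. ((\<lambda>x. G (set_coord w j x)) has_real_derivative y) (at x) \<and> 0 < y"
    using has_partial_derivative[OF x, of "[]"] partial_pos[OF x, of j] by auto
next
  show "continuous_on {s..t} (\<lambda>x. G (set_coord w j x))"
    using w s
    by (intro continuous_on_compose2[OF continuous continuous_on_set_coord])
       (auto simp: nonneg_orthant_def pos_orthant_def less_imp_le)
qed

lemma restrict_strict_mono:
  assumes Y: "Y \<in> pos_orthant" and j: "j \<notin> S"
  shows "G (restrict_to Y S) < G (restrict_to Y (S \<union> {j}))"
proof -
  have Yj: "0 < Y $ j" using Y by (simp add: pos_orthant_def)
  have S: "restrict_to Y S \<in> nonneg_orthant" "\<And>k. restrict_to Y S $ k \<le> Y $ k"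
    using Y by (auto simp: restrict_to_def nonneg_orthant_def pos_orthant_def less_imp_le)
  have eqs: "set_coord (restrict_to Y S) j 0 = restrict_to Y S"
    "set_coord (restrict_to Y S) j (Y $ j) = restrict_to Y (S \<union> {j})"
    using j by (auto simp: vec_eq_iff restrict_to_def)
  have "0 < G (set_coord Y j (Y $ j)) - G (set_coord Y j 0)"
    using strict_mono_coordinate[OF Y order_refl Yj, of j] by simp
  also have "\<dots> \<le> G (restrict_to Y (S \<union> {j})) - G (restrict_to Y S)"
    using decreasing_differences[OF S order_refl less_imp_le[OF Yj], of j]
    unfolding eqs .
  finally show ?thesis by simp
qed

end

theorem proposition1:
  fixes I :: "'i set"
    and q :: "'i \<Rightarrow> real"
    and v :: "'i \<Rightarrow> 'm::finite \<Rightarrow> real"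
    and G :: "'i \<Rightarrow> real ^ 'm \<Rightarrow> real"
    and S :: "'m set"
    and j :: 'm
  assumes "finite I" and "I \<noteq> {}"
    and "\<And>i. i \<in> I \<Longrightarrow> 0 < q i"
    and "\<And>i. i \<in> I \<Longrightarrow> cpgf (G i)"
    and "j \<notin> S"
  shows "f_GEV I q v G (S \<union> {j}) > f_GEV I q v G S"
proof -
  have "q i / (1 + G i (restrict_to (exp_utility v i) (S \<union> {j})))
      < q i / (1 + G i (restrict_to (exp_utility v i) S))" if i: "i \<in> I" for i
  proof -
    let ?Y = "exp_utility v i"
    interpret cpgf "G i" by (rule assms(4)[OF i])
    have Y: "?Y \<in> pos_orthant" by (simp add: exp_utility_def pos_orthant_def)
    then have "restrict_to ?Y S \<in> nonneg_orthant"
      by (auto simp: restrict_to_def nonneg_orthant_def pos_orthant_def less_imp_le)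
    then have "0 < 1 + G i (restrict_to ?Y S)" using nonneg[of "restrict_to ?Y S"] by linarith
    with restrict_strict_mono[OF Y assms(5)] assms(3)[OF i] show ?thesis
      by (intro divide_strict_left_mono) auto
  qed
  then have "(\<Sum>i\<in>I. q i / (1 + G i (restrict_to (exp_utility v i) (S \<union> {j}))))
      < (\<Sum>i\<in>I. q i / (1 + G i (restrict_to (exp_utility v i) S)))"
    using assms(1,2) by (intro sum_strict_mono)
  then show ?thesis unfolding f_GEV_def by simp
qed

end
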